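(* Fix $\alpha\in(0,1)$. Suppose the scores are pretrained, i.e. the scores $s_1,\dots,s_T$ observed along the stream are independent real random variables with $s_t\sim\mathcal D_t^{\mathsf{score}}$, each having a continuous cumulative distribution function. Let $1\le N^{\mathsf{cp}}\le T-1$ be an integer and $0<\mathsf{KS}_T\le T-1$. Then for any admissible algorithm $\pi\in\mathcal Q$, $$\mathsf{regret}_\pi\big(\mathcal L_1(N^{\mathsf{cp}}),T\big)=\Omega\big(\sqrt{(N^{\mathsf{cp}}+1)T}\big),\qquad \mathsf{regret}_\pi\big(\mathcal L_2(\mathsf{KS}_T),T\big)=\Omega\big(\sqrt T+(\mathsf{KS}_T)^{1/3}T^{2/3}\big).$$ Here $\Omega(\cdot)$ hides a positive constant that may depend on the fixed $\alpha$ only.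
   Context: Admissible algorithms $\mathcal Q$: let $U\sim\mathrm{Unif}(0,1)$ be a random seed independent of the data. $\mathcal Q$ is the set of all sequences $\pi=\{\pi_t\}_{t\ge1}$ of measurable maps $\pi_1:[0,1]\to\mathbb R$ and $\pi_t:\mathbb R^{t-1}\times[0,1]\to\mathbb R$ ($t\ge2$). The algorithm uses the quantile thresholds $q_1=\pi_1(U)$ and $q_t=\pi_t(s_{t-1},\dots,s_1,U)$ for $t\ge2$, where $s_t=s_t(X_t,Y_t)$ is the (pretrained) non-conformity score at time $t$; the prediction set at time $t$ is $\{y:s_t(X_t,y)\le q_t\}$. Distribution classes: $\mathcal D_t$ is the law of $(X_t,Y_t)$ and $\mathcal D_t^{\mathsf{score}}$ is the induced law of $s_t(X_t,Y_t)$. $\mathcal L_1(N^{\mathsf{cp}})$ is the set of sequences $(\mathcal D_1,\dots,\mathcal D_T)$ for which $(\mathcal D_1^{\mathsf{score}},\dots,\mathcal D_T^{\mathsf{score}})$ changes at most $N^{\mathsf{cp}}$ times (at most $N^{\mathsf{cp}}$ indices $t$ with $\mathcal D_t^{\mathsf{score}}\ne\mathcal D_{t+1}^{\mathsf{score}}$). $\mathcal L_2(\mathsf{KS}_T)$ is the set of sequences with $\sum_{t=1}^{T-1}\mathsf{KS}(\mathcal D_t^{\mathsf{score}},\mathcal D_{t+1}^{\mathsf{score}})\le\mathsf{KS}_T$, where $\mathsf{KS}(P,Q)=\sup_x|P((-\infty,x])-Q((-\infty,x])|$. Only the score laws matter: the classes are regarded as classes of sequences of score laws on $\mathbb R$ with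 continuous CDFs. Worst-case regret: for a class $\mathcal L$, $$\mathsf{regret}_\pi(\mathcal L,T)=\sup_{(\mathcal D_1,\dots,\mathcal D_T)\in\mathcal L}\sum_{t=1}^T\mathbb E\Big[\big|\mathbb P_{\mathcal D_t^{\mathsf{score}}}(s_t\le q_t\mid q_t)-(1-\alpha)\big|\Big],$$ where inside the absolute value $s_t\sim\mathcal D_t^{\mathsf{score}}$ is independent of $q_t$. *)

theory Defs
  imports "HOL-Probability.Probability"
begin

text \<open>Sequences are indexed by \<open>1, \<dots>, T\<close>; values at other indices are irrelevant.\<close>

definition KS :: "real measure \<Rightarrow> real measure \<Rightarrow> real" where
  "KS P Q = (SUP x. \<bar>cdf P x - cdf Q x\<bar>)"

definition score_laws :: "nat \<Rightarrow> (nat \<Rightarrow> real measure) set" where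
  "score_laws T =
     {D. \<forall>t\<in>{1..T}. real_distribution (D t) \<and> continuous_on UNIV (cdf (D t))}"

definition L1 :: "nat \<Rightarrow> nat \<Rightarrow> (nat \<Rightarrow> real measure) set" where
  "L1 T N = {D \<in> score_laws T. card {t \<in> {1..<T}. D t \<noteq> D (t + 1)} \<le> N}"

definition L2 :: "nat \<Rightarrow> real \<Rightarrow> (nat \<Rightarrow> real measure) set" where
  "L2 T K = {D \<in> score_laws T. (\<Sum>t = 1..<T. KS (D t) (D (t + 1))) \<le> K}"

text \<open>The map \<open>\<pi> t\<close> takes the past scores, a point of \<open>\<real>\<^bsup>{1..<t}\<^esup>\<close>, and the seed in
  \<open>[0, 1]\<close>. For \<open>t = 1\<close> the first factor is a one-point space.\<close>

type_synonym algorithm = "nat \<Rightarrow> (nat \<Rightarrow> real) \<times> real \<Rightarrow> real"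

definition admissible :: "algorithm set" where
  "admissible = {\<pi>. \<forall>t\<ge>1. \<pi> t \<in> borel_measurable
     ((\<Pi>\<^sub>M i\<in>{1..<t}. borel) \<Otimes>\<^sub>M restrict_space borel {0..1})}"

text \<open>The seed law is a measure on the space \<open>[0, 1]\<close> itself, not on \<open>\<real>\<close>, because \<open>\<pi> t\<close> is
  constrained to be measurable only there.\<close>

definition seed :: "real measure" where
  "seed = restrict_space lborel {0..1}"

text \<open>Joint law of the independent scores and the independent seed.\<close>

definition stream_law :: "nat \<Rightarrow> (nat \<Rightarrow> real measure) \<Rightarrow> ((nat \<Rightarrow> real) \<times> real) measure" where
  "stream_law T D = (\<Pi>\<^sub>M t\<in>{1..T}. D t) \<Otimes>\<^sub>M seed"

definition threshold :: "algorithm \<Rightarrow> nat \<Rightarrow> (nat \<Rightarrow> real) \<times> real \<Rightarrow> real" where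
  "threshold \<pi> t = (\<lambda>(s, u). \<pi> t (restrict s {1..<t}, u))"

text \<open>The inner probability is over a score \<open>x\<close> drawn from \<open>D t\<close> independently of the threshold.\<close>

definition regret ::
    "real \<Rightarrow> algorithm \<Rightarrow> (nat \<Rightarrow> real measure) set \<Rightarrow> nat \<Rightarrow> ereal" where
  "regret \<alpha> \<pi> L T = (SUP D\<in>L. ereal (\<Sum>t = 1..T.
     \<integral>\<omega>. \<bar>\<P>(x in D t. x \<le> threshold \<pi> t \<omega>) - (1 - \<alpha>)\<bar> \<partial>stream_law T D))"

end

theory Submission
  imports Defs
begin

text \<open>
  The lower bound is a two-point testing argument, repeated on blocks of time. Put mass \<open>w\<close>
  uniformly on \<open>[0, 1]\<close> and mass \<open>1 - w\<close> uniformly on \<open>(1, 2]\<close>. For the two weights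
  \<open>w = 1 - \<alpha> \<plusminus> \<delta>\<close> the CDFs pass the point \<open>1\<close> at the levels \<open>1 - \<alpha> \<plusminus> \<delta>\<close>, so that a threshold
  \<open>q \<ge> 1\<close> costs at least \<open>\<delta>\<close> under the larger weight and a threshold \<open>q \<le> 1\<close> costs at least \<open>\<delta>\<close>
  under the smaller one. Every threshold rule is therefore a test between the two
  laws, and it pays \<open>\<delta>\<close> whenever this test errs (\<open>two_point_expected_loss\<close>).

  Cut the time axis into blocks of length \<open>n\<close>, give every block its own sign, and let
  \<open>\<delta>\<close> be a small multiple of \<open>1 / sqrt n\<close>. Two sign patterns that differ in a single block give
  data streams whose \<open>\<chi>\<^sup>2\<close>-divergence is bounded, because \<open>1 + \<chi>\<^sup>2\<close> is multiplicative over
  independent coordinates and at most \<open>n\<close> of them change (\<open>block_weight_chi2\<close>). Hence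
  no test based on the stream recovers the sign of a block reliably
  (\<open>two_piece_stream_diff_le_half\<close>). Averaging over all sign patterns shows that some pattern
  costs the algorithm a constant multiple of \<open>T * \<delta>\<close>, i.e. of \<open>T / sqrt n\<close>
  (\<open>exists_hard_block_laws\<close>).

  It remains to choose \<open>n\<close> within the budget. There are \<open>(T - 1) div n\<close> block boundaries, and
  each one moves the CDF by at most \<open>2 * \<delta>\<close>. A budget of \<open>N\<close> changes permits \<open>n\<close> of order
  \<open>T / (N + 1)\<close>. A Kolmogorov--Smirnov budget \<open>K\<close> permits \<open>n\<close> with \<open>T / n * \<delta>\<close> of order \<open>K\<close>,
  that is \<open>n\<close> of order \<open>(T / K) powr (2/3)\<close>; a single block, \<open>n = T\<close>, uses no budget and gives
  the term \<open>sqrt T\<close>.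
\<close>

section \<open>Likelihood ratios on product spaces\<close>

text \<open>The difference is the mean of \<open>(f - 1) * indicator A\<close>, and the square of a mean is at most the
  mean square, here at most \<open>\<integral>(f - 1)\<^sup>2 \<partial>M = \<integral>f\<^sup>2 \<partial>M - 1\<close>. The last quantity is the
  \<open>\<chi>\<^sup>2\<close>-divergence of the two laws.\<close>

lemma density_measure_diff_le:
  fixes f :: "'a \<Rightarrow> real"
  assumes "prob_space M" and f[measurable]: "f \<in> borel_measurable M" and nonneg: "\<And>x. 0 \<le> f x"
    and "prob_space (density M f)"
    and sq: "integrable M (\<lambda>x. (f x)\<^sup>2)" "(\<integral>x. (f x)\<^sup>2 \<partial>M) \<le> 1 + \<epsilon>\<^sup>2" and "0 \<le> \<epsilon>"
    and A[measurable]: "A \<in> sets M"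
  shows "\<bar>measure (density M f) A - measure M A\<bar> \<le> \<epsilon>"
proof -
  interpret M: prob_space M by fact
  interpret N: prob_space "density M f" by fact
  have int1: "integrable M f"
    using integrable_density[of "\<lambda>_. 1::real" M f] nonneg by simp
  have Ef: "(\<integral>x. f x \<partial>M) = 1"
    using integral_density[of "\<lambda>_. 1::real" M f] nonneg N.prob_space by simp
  have int2: "integrable M (\<lambda>x. (f x - 1)\<^sup>2)"
    unfolding power2_diff using int1 sq by simp
  define X where "X = (\<lambda>x. (f x - 1) * indicator A x)"
  have X_sq: "(X x)\<^sup>2 = indicator A x * (f x - 1)\<^sup>2" for x
    by (simp add: X_def indicator_def)
  have intX: "integrable M X"
    unfolding X_def using integrable_mult_indicator[OF A, of "\<lambda>x. f x - 1"] int1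
    by (simp add: mult.commute)
  have intX2: "integrable M (\<lambda>x. (X x)\<^sup>2)"
    unfolding X_sq using integrable_mult_indicator[OF A int2] by simp
  have "measure (density M f) A = (\<integral>x. f x * indicator A x \<partial>M)"
    using integral_density[of "indicator A :: 'a \<Rightarrow> real" M f] nonneg
    by simp
  moreover have "measure M A = (\<integral>x. indicator A x \<partial>M)"
    by simp
  moreover have "integrable M (\<lambda>x. f x * indicator A x)"
    using integrable_mult_indicator[OF A int1] by (simp add: mult.commute)
  moreover have "integrable M (\<lambda>x. indicator A x :: real)"
    by (simp add: less_top[symmetric])
  ultimately have diff: "measure (density M f) A - measure M A = M.expectation X"
    unfolding X_def by (simp add: left_diff_distrib)
  have "(M.expectation X)\<^sup>2 \<le> M.expectation (\<lambda>x. (X x)\<^sup>2)"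
    using M.variance_positive[of X] M.variance_eq[OF intX intX2] by simp
  also have "\<dots> \<le> M.expectation (\<lambda>x. (f x - 1)\<^sup>2)"
    by (rule integral_mono[OF intX2 int2]) (simp add: X_sq indicator_def)
  also have "\<dots> = M.expectation (\<lambda>x. (f x)\<^sup>2) - 1"
    unfolding power2_diff using int1 sq Ef M.prob_space by simp
  also have "\<dots> \<le> \<epsilon>\<^sup>2"
    using sq by simp
  finally show ?thesis
    unfolding diff using \<open>0 \<le> \<epsilon>\<close> abs_le_square_iff[of "M.expectation X" \<epsilon>] by simp
qed

text \<open>Both sides agree on boxes, where the integral of a product of functions of separate coordinates
  factorises.\<close>

lemma density_PiM:
  fixes g :: "'i \<Rightarrow> 'a \<Rightarrow> ennreal"
  assumes "finite I" and M: "\<And>i. sigma_finite_measure (M i)"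
    and g[measurable]: "\<And>i. g i \<in> borel_measurable (M i)"
    and dens: "\<And>i. sigma_finite_measure (density (M i) (g i))"
  shows "density (PiM I M) (\<lambda>x. \<Prod>i\<in>I. g i (x i)) = PiM I (\<lambda>i. density (M i) (g i))"
proof -
  interpret M: product_sigma_finite M
    using M by (simp add: product_sigma_finite_def)
  interpret D: product_sigma_finite "\<lambda>i. density (M i) (g i)"
    using dens by (simp add: product_sigma_finite_def)
  have sets: "sets (PiM I (\<lambda>i. density (M i) (g i))) = sets (PiM I M)"
    by (intro sets_PiM_cong) auto
  show ?thesis
  proof (rule D.PiM_eqI)
    fix A assume A: "\<And>i. i \<in> I \<Longrightarrow> A i \<in> sets (density (M i) (g i))"
    have box: "PiE I A \<in> sets (PiM I M)"
      using A \<open>finite I\<close> by (intro sets_PiM_I_finite) auto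
    have "emeasure (density (PiM I M) (\<lambda>x. \<Prod>i\<in>I. g i (x i))) (PiE I A)
        = (\<integral>\<^sup>+x. (\<Prod>i\<in>I. g i (x i)) * indicator (PiE I A) x \<partial>PiM I M)"
      using box by (intro emeasure_density) simp_all
    also have "\<dots> = (\<integral>\<^sup>+x. (\<Prod>i\<in>I. g i (x i) * indicator (A i) (x i)) \<partial>PiM I M)"
    proof (intro nn_integral_cong)
      fix x assume "x \<in> space (PiM I M)"
      then have "(indicator (PiE I A) x :: ennreal) = (\<Prod>i\<in>I. indicator (A i) (x i))"
        using \<open>finite I\<close> by (auto simp: indicator_def space_PiM PiE_iff prod_zero_iff)
      then show "(\<Prod>i\<in>I. g i (x i)) * indicator (PiE I A) x = (\<Prod>i\<in>I. g i (x i) * indicator (A i) (x i))"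
        by (simp add: prod.distrib)
    qed
    also have "\<dots> = (\<Prod>i\<in>I. \<integral>\<^sup>+y. g i y * indicator (A i) y \<partial>M i)"
      using A \<open>finite I\<close> by (intro M.product_nn_integral_prod) auto
    also have "\<dots> = (\<Prod>i\<in>I. emeasure (density (M i) (g i)) (A i))"
      using A by (intro prod.cong refl) (simp add: emeasure_density)
    finally show "emeasure (density (PiM I M) (\<lambda>x. \<Prod>i\<in>I. g i (x i))) (PiE I A)
        = (\<Prod>i\<in>I. emeasure (density (M i) (g i)) (A i))" .
  qed (simp_all add: sets \<open>finite I\<close>)
qed

text \<open>The likelihood ratio of the product laws is the product of the coordinate ratios, so its second
  moment factorises. This is what makes the bound grow like the square root of
  the number of changed coordinates; adding up coordinatewise distances would make it grow
  linearly. The factor \<open>S\<close>, common to both laws, models the seed and leaves the ratio unchanged.\<close>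

lemma product_measure_diff_le:
  fixes g :: "'i \<Rightarrow> 'a \<Rightarrow> real"
  assumes "finite I" and M: "\<And>i. prob_space (M i)"
    and g[measurable]: "\<And>i. g i \<in> borel_measurable (M i)" and nonneg: "\<And>i x. 0 \<le> g i x"
    and dens: "\<And>i. prob_space (density (M i) (g i))"
    and sq: "\<And>i. i \<in> I \<Longrightarrow> integrable (M i) (\<lambda>x. (g i x)\<^sup>2)"
      "(\<Prod>i\<in>I. \<integral>x. (g i x)\<^sup>2 \<partial>M i) \<le> 1 + \<epsilon>\<^sup>2" and "0 \<le> \<epsilon>"
    and "prob_space S" and A: "A \<in> sets (PiM I M \<Otimes>\<^sub>M S)"
  shows "\<bar>measure (PiM I (\<lambda>i. density (M i) (g i)) \<Otimes>\<^sub>M S) A - measure (PiM I M \<Otimes>\<^sub>M S) A\<bar> \<le> \<epsilon>"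
proof -
  interpret M: product_prob_space M
    using M by (simp add: product_prob_space_def product_prob_space_axioms_def
        product_sigma_finite_def prob_space_imp_sigma_finite)
  interpret P: prob_space "PiM I M"
    using M by (intro prob_space_PiM)
  interpret Q: prob_space "PiM I (\<lambda>i. density (M i) (g i))"
    using dens by (intro prob_space_PiM)
  interpret S: prob_space S by fact
  interpret PS: pair_prob_space "PiM I M" S ..
  interpret QS: pair_prob_space "PiM I (\<lambda>i. density (M i) (g i))" S ..
  define f where "f = (\<lambda>x. \<Prod>i\<in>I. g i (x i))"
  have f[measurable]: "f \<in> borel_measurable (PiM I M)"
    unfolding f_def by measurable
  have "PiM I (\<lambda>i. density (M i) (g i)) = density (PiM I M) (\<lambda>x. \<Prod>i\<in>I. ennreal (g i (x i)))"
    using M dens by (intro density_PiM[symmetric] \<open>finite I\<close> prob_space_imp_sigma_finite) auto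
  then have ratio: "PiM I (\<lambda>i. density (M i) (g i)) = density (PiM I M) f"
    using nonneg by (simp add: f_def prod_ennreal)
  have "PiM I (\<lambda>i. density (M i) (g i)) \<Otimes>\<^sub>M S = density (PiM I M) f \<Otimes>\<^sub>M density S (\<lambda>_. 1)"
    by (simp add: ratio density_1)
  also have "\<dots> = density (PiM I M \<Otimes>\<^sub>M S) (\<lambda>(x, u). ennreal (f x) * 1)"
    by (intro pair_measure_density) (simp_all add: density_1 S.sigma_finite_measure_axioms)
  also have "\<dots> = density (PiM I M \<Otimes>\<^sub>M S) (\<lambda>\<omega>. f (fst \<omega>))"
    by (simp add: case_prod_beta')
  finally have ratio': "PiM I (\<lambda>i. density (M i) (g i)) \<Otimes>\<^sub>M S
      = density (PiM I M \<Otimes>\<^sub>M S) (\<lambda>\<omega>. f (fst \<omega>))" .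
  have f_sq: "(f x)\<^sup>2 = (\<Prod>i\<in>I. (g i (x i))\<^sup>2)" for x
    by (simp add: f_def prod_power_distrib)
  have int: "integrable (PiM I M) (\<lambda>x. (f x)\<^sup>2)"
    unfolding f_sq using sq \<open>finite I\<close> by (intro M.product_integrable_prod)
  have val: "(\<integral>x. (f x)\<^sup>2 \<partial>PiM I M) = (\<Prod>i\<in>I. \<integral>x. (g i x)\<^sup>2 \<partial>M i)"
    unfolding f_sq using sq \<open>finite I\<close> by (intro M.product_integral_prod)
  have fst_law: "distr (PiM I M \<Otimes>\<^sub>M S) (PiM I M) fst = PiM I M"
    by (rule S.distr_pair_fst)
  have int': "integrable (PiM I M \<Otimes>\<^sub>M S) (\<lambda>\<omega>. (f (fst \<omega>))\<^sup>2)"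
    using int by (subst (asm) fst_law[symmetric]) (simp add: integrable_distr_eq)
  have val': "(\<integral>\<omega>. (f (fst \<omega>))\<^sup>2 \<partial>(PiM I M \<Otimes>\<^sub>M S)) = (\<integral>x. (f x)\<^sup>2 \<partial>PiM I M)"
    by (subst (2) fst_law[symmetric]) (simp add: integral_distr)
  have nonneg': "0 \<le> f x" for x
    using nonneg by (simp add: f_def prod_nonneg)
  show ?thesis
    unfolding ratio'
  proof (rule density_measure_diff_le)
    show "prob_space (density (PiM I M \<Otimes>\<^sub>M S) (\<lambda>\<omega>. f (fst \<omega>)))"
      unfolding ratio'[symmetric] by (rule QS.prob_space_axioms)
  qed (use int' val' val sq nonneg' A \<open>0 \<le> \<epsilon>\<close> PS.prob_space_axioms in auto)
qed

section \<open>Two-piece score laws\<close>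

definition two_piece_law :: "real \<Rightarrow> real measure" where
  "two_piece_law w = density lborel
     (\<lambda>x. ennreal (w * indicator {0..1} x + (1 - w) * indicator {1<..2} x))"

lemma sets_two_piece_law [measurable_cong, simp]: "sets (two_piece_law w) = sets borel"
  by (simp add: two_piece_law_def)

lemma space_two_piece_law [simp]: "space (two_piece_law w) = UNIV"
  by (simp add: two_piece_law_def)

lemma emeasure_two_piece_law:
  assumes "0 \<le> w" "w \<le> 1" and [measurable]: "A \<in> sets borel"
  shows "emeasure (two_piece_law w) A
    = ennreal (w * measure lborel ({0..1} \<inter> A) + (1 - w) * measure lborel ({1<..2} \<inter> A))"
proof -
  have fin: "emeasure lborel ({0..1} \<inter> A) < \<infinity>" "emeasure lborel ({1<..2} \<inter> A) < \<infinity>"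
    by (auto intro: le_less_trans[OF emeasure_mono, of _ "{0..1::real}"]
        le_less_trans[OF emeasure_mono, of _ "{1<..2::real}"])
  have "emeasure (two_piece_law w) A
    = (\<integral>\<^sup>+x. ennreal w * indicator ({0..1} \<inter> A) x + ennreal (1 - w) * indicator ({1<..2} \<inter> A) x \<partial>lborel)"
    unfolding two_piece_law_def using assms
    by (subst emeasure_density) (auto intro!: nn_integral_cong simp: indicator_def)
  also have "\<dots> = ennreal w * emeasure lborel ({0..1} \<inter> A) + ennreal (1 - w) * emeasure lborel ({1<..2} \<inter> A)"
    by (simp add: nn_integral_add nn_integral_cmult)
  also have "\<dots> = ennreal (w * measure lborel ({0..1} \<inter> A) + (1 - w) * measure lborel ({1<..2} \<inter> A))"
    using fin assms by (simp add: emeasure_eq_ennreal_measure ennreal_mult[symmetric] ennreal_plus[symmetric]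
        measure_nonneg del: ennreal_plus)
  finally show ?thesis .
qed

lemma measure_two_piece_law:
  assumes "0 \<le> w" "w \<le> 1" "A \<in> sets borel"
  shows "measure (two_piece_law w) A
    = w * measure lborel ({0..1} \<inter> A) + (1 - w) * measure lborel ({1<..2} \<inter> A)"
  using emeasure_two_piece_law[OF assms] assms by (simp add: measure_def del: ennreal_plus)

lemma prob_space_two_piece_law:
  assumes "0 \<le> w" "w \<le> 1"
  shows "prob_space (two_piece_law w)"
  using emeasure_two_piece_law[OF assms, of UNIV] by (intro prob_spaceI) simp

lemma real_distribution_two_piece_law:
  assumes "0 \<le> w" "w \<le> 1"
  shows "real_distribution (two_piece_law w)"
  using prob_space_two_piece_law[OF assms]
  by (simp add: real_distribution_def real_distribution_axioms_def)

lemma continuous_cdf_two_piece_law: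
  assumes "0 \<le> w" "w \<le> 1"
  shows "continuous_on UNIV (cdf (two_piece_law w))"
proof -
  interpret real_distribution "two_piece_law w"
    using assms by (rule real_distribution_two_piece_law)
  have "measure lborel (B \<inter> {x}) = 0" for B :: "real set" and x
    by (cases "x \<in> B") (auto simp: measure_def)
  then have "measure (two_piece_law w) {x} = 0" for x
    using assms by (simp add: measure_two_piece_law)
  then show ?thesis
    by (simp add: continuous_at_imp_continuous_on isCont_cdf)
qed

lemma cdf_two_piece_law_at_1:
  assumes "0 \<le> w" "w \<le> 1"
  shows "cdf (two_piece_law w) 1 = w"
proof -
  have "{0..1} \<inter> {..1} = {0..1::real}" "{1<..2} \<inter> {..1} = ({}::real set)"
    by auto
  then show ?thesis
    using assms by (simp add: cdf_def measure_two_piece_law)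
qed

text \<open>The CDF at \<open>x\<close> is the average \<open>w * a + (1 - w) * b\<close> of the two uniform CDFs at \<open>x\<close>, hence affine in
  the weight with slope \<open>a - b\<close>.\<close>

lemma KS_two_piece_law_le:
  assumes "0 \<le> v" "v \<le> 1" "0 \<le> w" "w \<le> 1"
  shows "KS (two_piece_law v) (two_piece_law w) \<le> \<bar>v - w\<bar>"
  unfolding KS_def
proof (rule cSUP_least)
  fix x :: real
  define a b where "a = measure lborel ({0..1} \<inter> {..x})" and "b = measure lborel ({1<..2} \<inter> {..x})"
  have "a \<le> measure lborel {0..1::real}"
    unfolding a_def by (rule measure_mono_fmeasurable) (auto simp: fmeasurable_def)
  moreover have "b \<le> measure lborel {1<..2::real}"
    unfolding b_def by (rule measure_mono_fmeasurable) (auto simp: fmeasurable_def)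
  moreover have "0 \<le> a" "0 \<le> b"
    by (simp_all add: a_def b_def)
  ultimately have "\<bar>a - b\<bar> \<le> 1" by auto
  have "cdf (two_piece_law v) x - cdf (two_piece_law w) x = (v - w) * (a - b)"
    using assms by (simp add: cdf_def measure_two_piece_law a_def b_def algebra_simps)
  then show "\<bar>cdf (two_piece_law v) x - cdf (two_piece_law w) x\<bar> \<le> \<bar>v - w\<bar>"
    using \<open>\<bar>a - b\<bar> \<le> 1\<close> by (simp add: abs_mult mult_left_le)
qed simp

definition two_piece_ratio :: "real \<Rightarrow> real \<Rightarrow> real \<Rightarrow> real" where
  "two_piece_ratio v w x = (if x \<le> 1 then v / w else (1 - v) / (1 - w))"

lemma measurable_two_piece_ratio [measurable]: "two_piece_ratio v w \<in> borel_measurable borel"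
  unfolding two_piece_ratio_def by measurable

lemma two_piece_ratio_nonneg:
  assumes "0 \<le> v" "v \<le> 1" "0 < w" "w < 1"
  shows "0 \<le> two_piece_ratio v w x"
  using assms by (simp add: two_piece_ratio_def)

lemma density_two_piece_ratio:
  assumes "0 \<le> v" "v \<le> 1" "0 < w" "w < 1"
  shows "density (two_piece_law w) (two_piece_ratio v w) = two_piece_law v"
  unfolding two_piece_law_def using assms
  by (subst density_density_eq)
    (auto intro!: density_cong simp: two_piece_ratio_def ennreal_mult[symmetric] split: split_indicator)

lemma two_piece_ratio_square:
  assumes "0 \<le> v" "v \<le> 1" "0 < w" "w < 1"
  shows "integrable (two_piece_law w) (\<lambda>x. (two_piece_ratio v w x)\<^sup>2)"
    and "(\<integral>x. (two_piece_ratio v w x)\<^sup>2 \<partial>two_piece_law w) = 1 + (v - w)\<^sup>2 / (w * (1 - w))"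
proof -
  interpret real_distribution "two_piece_law w"
    using assms by (intro real_distribution_two_piece_law) auto
  have ratio: "(two_piece_ratio v w x)\<^sup>2
      = ((1 - v) / (1 - w))\<^sup>2 + ((v / w)\<^sup>2 - ((1 - v) / (1 - w))\<^sup>2) * indicator {..1} x" for x
    by (simp add: two_piece_ratio_def)
  have int: "integrable (two_piece_law w) (indicator {..1} :: real \<Rightarrow> real)"
    by (simp add: less_top[symmetric])
  show "integrable (two_piece_law w) (\<lambda>x. (two_piece_ratio v w x)\<^sup>2)"
    unfolding ratio using int by simp
  have "(\<integral>x. (two_piece_ratio v w x)\<^sup>2 \<partial>two_piece_law w)
      = ((1 - v) / (1 - w))\<^sup>2 + ((v / w)\<^sup>2 - ((1 - v) / (1 - w))\<^sup>2) * w"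
    unfolding ratio using int prob_space assms cdf_two_piece_law_at_1[of w] by (simp add: cdf_def)
  also have "\<dots> = 1 + (v - w)\<^sup>2 / (w * (1 - w))"
    using assms by (simp add: divide_simps power2_eq_square) (simp add: algebra_simps)
  finally show "(\<integral>x. (two_piece_ratio v w x)\<^sup>2 \<partial>two_piece_law w) = 1 + (v - w)\<^sup>2 / (w * (1 - w))" .
qed


lemma prob_space_seed: "prob_space seed"
  unfolding seed_def by (intro prob_spaceI) (simp add: space_restrict_space emeasure_restrict_space)

text \<open>By \<open>two_piece_ratio_square\<close> each coordinate multiplies the second moment of the likelihood ratio by
  one plus its \<open>\<chi>\<^sup>2\<close>-divergence. The product is at most \<open>exp (1/8)\<close>, which is below
  \<open>1 + (1/2)\<^sup>2\<close>.\<close>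

lemma two_piece_stream_diff_le_half:
  fixes v w :: "nat \<Rightarrow> real"
  assumes v: "\<And>i. 0 \<le> v i" "\<And>i. v i \<le> 1" and w: "\<And>i. 0 < w i" "\<And>i. w i < 1"
    and chi2: "(\<Sum>i = 1..T. (v i - w i)\<^sup>2 / (w i * (1 - w i))) \<le> 1 / 8"
    and A: "A \<in> sets (stream_law T (\<lambda>i. two_piece_law (w i)))"
  shows "\<bar>measure (stream_law T (\<lambda>i. two_piece_law (v i))) A
      - measure (stream_law T (\<lambda>i. two_piece_law (w i))) A\<bar> \<le> 1 / 2"
proof -
  have dens: "density (two_piece_law (w i)) (two_piece_ratio (v i) (w i)) = two_piece_law (v i)" for i
    using v w by (rule density_two_piece_ratio)
  let ?sq = "\<lambda>i. \<integral>x. (two_piece_ratio (v i) (w i) x)\<^sup>2 \<partial>two_piece_law (w i)"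
  have "(\<Prod>i\<in>{1..T}. ?sq i) = (\<Prod>i\<in>{1..T}. 1 + (v i - w i)\<^sup>2 / (w i * (1 - w i)))"
    using v w by (intro prod.cong refl two_piece_ratio_square)
  also have "\<dots> \<le> (\<Prod>i\<in>{1..T}. exp ((v i - w i)\<^sup>2 / (w i * (1 - w i))))"
    using w by (intro prod_mono conjI exp_ge_add_one_self add_nonneg_nonneg divide_nonneg_nonneg mult_nonneg_nonneg)
      (auto simp: less_imp_le)
  also have "\<dots> \<le> exp (1 / 8)"
    using chi2 by (simp add: exp_sum[symmetric])
  also have "\<dots> \<le> 1 + (1 / 2)\<^sup>2"
    using exp_bound[of "1 / 8"] by (simp add: power2_eq_square)
  finally have sq: "(\<Prod>i\<in>{1..T}. ?sq i) \<le> 1 + (1 / 2)\<^sup>2" .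
  have "\<bar>measure (PiM {1..T} (\<lambda>i. density (two_piece_law (w i)) (two_piece_ratio (v i) (w i))) \<Otimes>\<^sub>M seed) A
      - measure (PiM {1..T} (\<lambda>i. two_piece_law (w i)) \<Otimes>\<^sub>M seed) A\<bar> \<le> 1 / 2"
  proof (rule product_measure_diff_le)
    show "prob_space (two_piece_law (w i))" for i
      using w by (intro prob_space_two_piece_law less_imp_le)
    show "prob_space (density (two_piece_law (w i)) (two_piece_ratio (v i) (w i)))" for i
      unfolding dens using v by (rule prob_space_two_piece_law)
  qed (use v w sq A prob_space_seed in \<open>auto simp: stream_law_def
      intro!: two_piece_ratio_nonneg two_piece_ratio_square\<close>)
  then show ?thesis
    by (simp add: dens stream_law_def)
qed

section \<open>The loss of a threshold rule\<close>

definition expected_loss :: "real \<Rightarrow> algorithm \<Rightarrow> nat \<Rightarrow> (nat \<Rightarrow> real measure) \<Rightarrow> nat \<Rightarrow> real" where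
  "expected_loss \<alpha> \<pi> T D t = (\<integral>\<omega>. \<bar>cdf (D t) (threshold \<pi> t \<omega>) - (1 - \<alpha>)\<bar> \<partial>stream_law T D)"

lemma regret_ge_sum_expected_loss:
  assumes "D \<in> L" and "L \<subseteq> score_laws T"
  shows "ereal (\<Sum>t = 1..T. expected_loss \<alpha> \<pi> T D t) \<le> regret \<alpha> \<pi> L T"
proof -
  have "\<P>(x in D t. x \<le> q) = cdf (D t) q" if "t \<in> {1..T}" for t q
  proof -
    interpret real_distribution "D t"
      using assms that by (auto simp: score_laws_def)
    show ?thesis by (simp add: cdf_def atMost_def)
  qed
  then have "(\<Sum>t = 1..T. expected_loss \<alpha> \<pi> T D t) = (\<Sum>t = 1..T.
      \<integral>\<omega>. \<bar>\<P>(x in D t. x \<le> threshold \<pi> t \<omega>) - (1 - \<alpha>)\<bar> \<partial>stream_law T D)"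
    by (simp add: expected_loss_def)
  then show ?thesis
    unfolding regret_def using \<open>D \<in> L\<close> by (auto intro: SUP_upper2)
qed

lemma prob_space_stream_law:
  assumes "\<And>i. prob_space (D i)"
  shows "prob_space (stream_law T D)"
  unfolding stream_law_def
  by (intro prob_space_pair prob_space_PiM assms prob_space_seed)

text \<open>A rule \<open>\<pi> t\<close> is measurable on the past coordinates and the seed; the threshold reads these off the
  whole stream by a measurable projection.\<close>

lemma measurable_threshold:
  assumes "\<pi> \<in> admissible" "t \<in> {1..T}" and D: "\<And>i. sets (D i) = sets borel"
  shows "threshold \<pi> t \<in> borel_measurable (stream_law T D)"
proof -
  have [measurable_cong]: "sets seed = sets (restrict_space borel {0..1})"
    unfolding seed_def by (intro sets_restrict_space_cong) simp
  have eq: "sets (stream_law T D) = sets ((\<Pi>\<^sub>M i\<in>{1..T}. borel) \<Otimes>\<^sub>M restrict_space borel {0..1})"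
    unfolding stream_law_def using D
    by (intro sets_pair_measure_cong sets_PiM_cong) (simp_all add: seed_def sets_restrict_space)
  have "\<pi> t \<in> borel_measurable ((\<Pi>\<^sub>M i\<in>{1..<t}. borel) \<Otimes>\<^sub>M restrict_space borel {0..1})"
    using assms by (simp add: admissible_def)
  moreover have "(\<lambda>(s, u). (restrict s {1..<t}, u)) \<in>
      ((\<Pi>\<^sub>M i\<in>{1..T}. borel :: real measure) \<Otimes>\<^sub>M restrict_space borel {0..1::real})
      \<rightarrow>\<^sub>M ((\<Pi>\<^sub>M i\<in>{1..<t}. borel) \<Otimes>\<^sub>M restrict_space borel {0..1})"
    unfolding case_prod_beta'
    by (intro measurable_Pair measurable_compose[OF measurable_fst measurable_restrict_subset] measurable_snd)
      (use assms(2) in auto)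
  ultimately have "threshold \<pi> t \<in> borel_measurable
      ((\<Pi>\<^sub>M i\<in>{1..T}. borel) \<Otimes>\<^sub>M restrict_space borel {0..1})"
    unfolding threshold_def case_prod_beta' by (rule measurable_compose[rotated])
  then show ?thesis
    by (simp add: measurable_cong_sets[OF eq refl])
qed

text \<open>The loss is bounded and measurable, hence integrable; its Bochner integral is then a genuine
  expectation, and Markov's inequality applies.\<close>

lemma expected_loss_ge:
  assumes "\<pi> \<in> admissible" "t \<in> {1..T}" and D: "\<And>i. real_distribution (D i)"
    and A: "A \<in> sets (stream_law T D)"
    and loss: "\<And>\<omega>. \<omega> \<in> A \<Longrightarrow> \<delta> \<le> \<bar>cdf (D t) (threshold \<pi> t \<omega>) - (1 - \<alpha>)\<bar>"
  shows "\<delta> * measure (stream_law T D) A \<le> expected_loss \<alpha> \<pi> T D t"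
proof -
  interpret Dt: real_distribution "D t" by (rule D)
  interpret S: prob_space "stream_law T D"
    using D by (intro prob_space_stream_law) (simp add: real_distribution_def)
  have [measurable]: "threshold \<pi> t \<in> borel_measurable (stream_law T D)"
    using assms(1,2) real_distribution.events_eq_borel[OF D] by (rule measurable_threshold)
  have [measurable]: "cdf (D t) \<in> borel_measurable borel"
    by (intro borel_measurable_mono monoI Dt.cdf_nondecreasing)
  have "\<bar>cdf (D t) q - (1 - \<alpha>)\<bar> \<le> 2 + \<bar>\<alpha>\<bar>" for q
    using Dt.cdf_nonneg[of q] Dt.cdf_bounded_prob[of q] by linarith
  then have int: "integrable (stream_law T D) (\<lambda>\<omega>. \<bar>cdf (D t) (threshold \<pi> t \<omega>) - (1 - \<alpha>)\<bar>)"
    by (intro S.integrable_const_bound[of _ "2 + \<bar>\<alpha>\<bar>"]) simp_all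
  have int_A: "integrable (stream_law T D) (\<lambda>\<omega>. \<delta> * indicator A \<omega> :: real)"
    using A by (intro integrable_mult_right integrable_real_indicator) (simp_all add: less_top[symmetric])
  have "\<delta> * measure (stream_law T D) A = (\<integral>\<omega>. \<delta> * indicator A \<omega> \<partial>stream_law T D)"
    using A by simp
  also have "\<dots> \<le> expected_loss \<alpha> \<pi> T D t"
    unfolding expected_loss_def
    using loss by (intro integral_mono int int_A) (auto simp: indicator_def)
  finally show ?thesis .
qed

text \<open>The event \<open>1 \<le> q\<close> decides for the smaller weight \<open>1 - \<alpha> - \<delta>\<close> and its complement for the larger
  one, because \<open>cdf (two_piece_law w) 1 = w\<close> and CDFs are monotone. The two error probabilities add up to at least one minus the total
  variation distance, and each error costs \<open>\<delta>\<close>.\<close>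

lemma two_point_expected_loss:
  assumes "0 < \<alpha>" "\<alpha> < 1" "\<pi> \<in> admissible" "t \<in> {1..T}"
    and v: "\<And>i. 0 < v i" "\<And>i. v i < 1" and w: "\<And>i. 0 < w i" "\<And>i. w i < 1"
    and chi2: "(\<Sum>i = 1..T. (v i - w i)\<^sup>2 / (w i * (1 - w i))) \<le> 1 / 8"
    and "0 \<le> \<delta>" "v t = 1 - \<alpha> + \<delta>" "w t = 1 - \<alpha> - \<delta>"
  shows "\<delta> / 2 \<le> expected_loss \<alpha> \<pi> T (\<lambda>i. two_piece_law (v i)) t
      + expected_loss \<alpha> \<pi> T (\<lambda>i. two_piece_law (w i)) t"
proof -
  let ?P = "stream_law T (\<lambda>i. two_piece_law (v i))" and ?Q = "stream_law T (\<lambda>i. two_piece_law (w i))"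
  define A where "A = {\<omega> \<in> space ?P. 1 \<le> threshold \<pi> t \<omega>}"
  have distr: "real_distribution (two_piece_law (v i))" "real_distribution (two_piece_law (w i))" for i
    using v[of i] w[of i] by (auto intro!: real_distribution_two_piece_law)
  interpret V: real_distribution "two_piece_law (v t)" by (rule distr)
  interpret W: real_distribution "two_piece_law (w t)" by (rule distr)
  interpret Q: prob_space ?Q
    using distr by (intro prob_space_stream_law) (simp add: real_distribution_def)
  have sets_eq: "sets ?P = sets ?Q"
    unfolding stream_law_def by (intro sets_pair_measure_cong sets_PiM_cong) simp_all
  have [measurable]: "threshold \<pi> t \<in> borel_measurable ?P"
    using assms(3,4) by (rule measurable_threshold) simp
  have A: "A \<in> sets ?P"
    unfolding A_def by measurable
  have "\<delta> * measure ?P A \<le> expected_loss \<alpha> \<pi> T (\<lambda>i. two_piece_law (v i)) t"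
  proof (rule expected_loss_ge[OF assms(3,4) distr(1) A])
    fix \<omega> assume "\<omega> \<in> A"
    then have "v t \<le> cdf (two_piece_law (v t)) (threshold \<pi> t \<omega>)"
      using V.cdf_nondecreasing[of 1] cdf_two_piece_law_at_1[of "v t"] v[of t] by (simp add: A_def)
    then show "\<delta> \<le> \<bar>cdf (two_piece_law (v t)) (threshold \<pi> t \<omega>) - (1 - \<alpha>)\<bar>"
      using assms by simp
  qed
  moreover have "\<delta> * measure ?Q (space ?Q - A) \<le> expected_loss \<alpha> \<pi> T (\<lambda>i. two_piece_law (w i)) t"
  proof (rule expected_loss_ge[OF assms(3,4) distr(2)])
    show "space ?Q - A \<in> sets ?Q" using A sets_eq by auto
    fix \<omega> assume "\<omega> \<in> space ?Q - A"
    then have "threshold \<pi> t \<omega> \<le> 1"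
      using sets_eq_imp_space_eq[OF sets_eq] by (auto simp: A_def)
    then have "cdf (two_piece_law (w t)) (threshold \<pi> t \<omega>) \<le> w t"
      using W.cdf_nondecreasing[of _ 1] cdf_two_piece_law_at_1[of "w t"] w[of t] by simp
    then show "\<delta> \<le> \<bar>cdf (two_piece_law (w t)) (threshold \<pi> t \<omega>) - (1 - \<alpha>)\<bar>"
      using assms by simp
  qed
  moreover have "measure ?Q (space ?Q - A) = 1 - measure ?Q A"
    using A sets_eq by (intro Q.prob_compl) simp
  moreover have "\<bar>measure ?P A - measure ?Q A\<bar> \<le> 1 / 2"
    using v w chi2 A by (intro two_piece_stream_diff_le_half) (auto simp: sets_eq less_imp_le)
  then have "1 / 2 \<le> measure ?P A + (1 - measure ?Q A)"
    unfolding abs_le_iff by linarith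
  then have "\<delta> * (1 / 2) \<le> \<delta> * (measure ?P A + (1 - measure ?Q A))"
    using \<open>0 \<le> \<delta>\<close> by (rule mult_left_mono)
  ultimately show ?thesis
    by (simp add: distrib_left)
qed

section \<open>Sign patterns on blocks\<close>

text \<open>The order \<open>1 / sqrt n\<close> is the finest resolution of \<open>n\<close> samples. The factor \<open>min \<alpha> (1 - \<alpha>)\<close> keeps
  the weights \<open>1 - \<alpha> \<plusminus> \<delta>\<close> away from \<open>0\<close> and \<open>1\<close>, and the constant \<open>8\<close> makes the
  \<open>\<chi>\<^sup>2\<close>-divergences of the \<open>n\<close> coordinates of a block add up to at most \<open>1 / 8\<close>.\<close>

definition block_amplitude :: "real \<Rightarrow> nat \<Rightarrow> real" where
  "block_amplitude \<alpha> n = min \<alpha> (1 - \<alpha>) / (8 * sqrt (real n))"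

text \<open>Time starts at \<open>1\<close>, so \<open>(t - 1) div n\<close> is the index, counted from \<open>0\<close>, of the block of \<open>t\<close>. The
  set \<open>S\<close> collects the blocks of positive sign.\<close>

definition block_weight :: "real \<Rightarrow> nat \<Rightarrow> nat set \<Rightarrow> nat \<Rightarrow> real" where
  "block_weight \<alpha> n S t = 1 - \<alpha> +
     (if (t - 1) div n \<in> S then block_amplitude \<alpha> n else - block_amplitude \<alpha> n)"

definition block_laws :: "real \<Rightarrow> nat \<Rightarrow> nat set \<Rightarrow> nat \<Rightarrow> real measure" where
  "block_laws \<alpha> n S t = two_piece_law (block_weight \<alpha> n S t)"

lemma block_amplitude_bounds:
  assumes "0 < \<alpha>" "\<alpha> < 1" "1 \<le> n"
  shows "0 < block_amplitude \<alpha> n" "block_amplitude \<alpha> n \<le> min \<alpha> (1 - \<alpha>) / 8"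
proof -
  define m where "m = min \<alpha> (1 - \<alpha>)"
  have "0 < m" "1 \<le> sqrt (real n)" using assms by (auto simp: m_def)
  then show "0 < block_amplitude \<alpha> n" "block_amplitude \<alpha> n \<le> min \<alpha> (1 - \<alpha>) / 8"
    unfolding block_amplitude_def m_def[symmetric] by (simp, intro frac_le) simp_all
qed

lemma block_weight_bounds:
  assumes "0 < \<alpha>" "\<alpha> < 1" "1 \<le> n"
  shows "0 < block_weight \<alpha> n S t" "block_weight \<alpha> n S t < 1"
    and "min \<alpha> (1 - \<alpha>) / 4 \<le> block_weight \<alpha> n S t * (1 - block_weight \<alpha> n S t)"
proof -
  define m where "m = min \<alpha> (1 - \<alpha>)"
  let ?w = "block_weight \<alpha> n S t"
  have m: "0 < m" "m \<le> \<alpha>" "m \<le> 1 - \<alpha>" using assms by (auto simp: m_def)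
  have w: "m / 2 \<le> ?w" "m / 2 \<le> 1 - ?w"
    using block_amplitude_bounds[OF assms] m unfolding block_weight_def m_def[symmetric] by auto
  then show "0 < ?w" "?w < 1" using m by auto
  have "m / 2 * (1 / 2) \<le> ?w * (1 - ?w)"
  proof (cases "?w \<le> 1 / 2")
    case True
    then show ?thesis using w m by (intro mult_mono) auto
  next
    case False
    then have "1 / 2 * (m / 2) \<le> ?w * (1 - ?w)"
      using w m by (intro mult_mono) auto
    then show ?thesis by simp
  qed
  then show "min \<alpha> (1 - \<alpha>) / 4 \<le> ?w * (1 - ?w)" by (simp add: m_def)
qed

text \<open>Only the at most \<open>n\<close> times in block \<open>b\<close> contribute. With \<open>m = min \<alpha> (1 - \<alpha>)\<close>, each contributes at
  most \<open>(2 * \<delta>)\<^sup>2 / (m / 4) = m / (4 * n) \<le> 1 / (8 * n)\<close>.\<close>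

lemma block_weight_chi2:
  fixes b :: nat and S :: "nat set"
  assumes "0 < \<alpha>" "\<alpha> < 1" "1 \<le> n"
  defines "v \<equiv> block_weight \<alpha> n (insert b S)" and "w \<equiv> block_weight \<alpha> n S"
  shows "(\<Sum>i = 1..T. (v i - w i)\<^sup>2 / (w i * (1 - w i))) \<le> 1 / 8"
proof -
  define m where "m = min \<alpha> (1 - \<alpha>)"
  have m: "0 < m" "m \<le> 1 / 2" using assms by (auto simp: m_def min_def)
  define B where "B = {i \<in> {1..T}. (i - 1) div n = b}"
  have "B \<subseteq> {b * n + 1..b * n + n}"
  proof
    fix i assume i: "i \<in> B"
    define r where "r = (i - 1) mod n"
    have "r < n" using assms(3) by (simp add: r_def)
    moreover have "b * n + r = i - 1" "1 \<le> i"
      using i unfolding B_def r_def by (auto simp only: mem_Collect_eq atLeastAtMost_iff div_mult_mod_eq)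
    ultimately show "i \<in> {b * n + 1..b * n + n}" by auto
  qed
  then have card: "card B \<le> n"
    using card_mono[of "{b * n + 1..b * n + n}" B] by simp
  have amp: "(block_amplitude \<alpha> n)\<^sup>2 = m\<^sup>2 / (64 * real n)"
    unfolding block_amplitude_def m_def[symmetric] by (simp add: power_divide power_mult_distrib)
  have summand: "(v i - w i)\<^sup>2 / (w i * (1 - w i)) \<le> 1 / (8 * real n)" for i
  proof -
    have lower: "m / 4 \<le> w i * (1 - w i)"
      using block_weight_bounds(3)[OF assms(1-3)] by (simp add: w_def m_def)
    have "\<bar>v i - w i\<bar> \<le> 2 * block_amplitude \<alpha> n"
      using block_amplitude_bounds[OF assms(1-3)] by (simp add: v_def w_def block_weight_def)
    then have "(v i - w i)\<^sup>2 \<le> (2 * block_amplitude \<alpha> n)\<^sup>2"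
      by (metis abs_ge_zero power2_abs power_mono)
    also have "\<dots> = m\<^sup>2 / (16 * real n)"
      by (simp add: power_mult_distrib amp)
    finally have "(v i - w i)\<^sup>2 / (w i * (1 - w i)) \<le> (m\<^sup>2 / (16 * real n)) / (m / 4)"
      using lower m by (intro frac_le) auto
    also have "\<dots> = m / (4 * real n)"
      using m by (simp add: power2_eq_square)
    also have "\<dots> \<le> 1 / (8 * real n)"
      using m assms by (simp add: field_simps)
    finally show ?thesis .
  qed
  have "(\<Sum>i = 1..T. (v i - w i)\<^sup>2 / (w i * (1 - w i))) = (\<Sum>i\<in>B. (v i - w i)\<^sup>2 / (w i * (1 - w i)))"
    by (rule sum.mono_neutral_right) (auto simp: B_def v_def w_def block_weight_def)
  also have "\<dots> \<le> real (card B) * (1 / (8 * real n))"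
    using summand by (intro sum_bounded_above)
  also have "\<dots> \<le> real n * (1 / (8 * real n))"
    using card by (intro mult_right_mono) auto
  finally show ?thesis using assms by simp
qed

text \<open>Averaging over sign patterns by pairing each pattern with the one that has the sign of \<open>b\<close>
  flipped.\<close>

lemma sum_Pow_pair_ge:
  fixes g :: "'a set \<Rightarrow> real"
  assumes "finite U" "b \<in> U" and pair: "\<And>S. b \<notin> S \<Longrightarrow> c \<le> g S + g (insert b S)"
  shows "2 ^ card U * (c / 2) \<le> (\<Sum>S\<in>Pow U. g S)"
proof -
  define V where "V = U - {b}"
  have V: "finite V" "b \<notin> V" "U = insert b V" using assms by (auto simp: V_def)
  have "(\<Sum>S\<in>Pow U. g S) = (\<Sum>S\<in>Pow V. g S) + (\<Sum>S\<in>insert b ` Pow V. g S)"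
    unfolding V(3) Pow_insert using V by (intro sum.union_disjoint) auto
  also have "(\<Sum>S\<in>insert b ` Pow V. g S) = (\<Sum>S\<in>Pow V. g (insert b S))"
    using V(2) by (subst sum.reindex) (auto simp: inj_on_def dest!: insert_ident[THEN iffD1, rotated 2])
  finally have "(\<Sum>S\<in>Pow U. g S) = (\<Sum>S\<in>Pow V. g S + g (insert b S))"
    by (simp add: sum.distrib)
  also have "\<dots> \<ge> (\<Sum>S\<in>Pow V. c)"
    using V(2) by (intro sum_mono pair) auto
  finally show ?thesis
    using V by (simp add: card_Pow)
qed

text \<open>For every time \<open>t\<close> the patterns are paired by flipping the sign of the block of \<open>t\<close>, so the
  average loss at \<open>t\<close> over all patterns is at least \<open>\<delta> / 4\<close>. The pairing depends on \<open>t\<close>, the average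
  does not; hence the total loss has average at least \<open>T * \<delta> / 4\<close>, and some pattern costs at least the average.\<close>

lemma exists_hard_block_laws:
  assumes \<alpha>: "0 < \<alpha>" "\<alpha> < 1" and "1 \<le> n" and "\<pi> \<in> admissible"
  shows "\<exists>S. real T * (block_amplitude \<alpha> n / 4) \<le> (\<Sum>t = 1..T. expected_loss \<alpha> \<pi> T (block_laws \<alpha> n S) t)"
proof (rule ccontr)
  let ?loss = "\<lambda>S t. expected_loss \<alpha> \<pi> T (block_laws \<alpha> n S) t"
  let ?\<delta> = "block_amplitude \<alpha> n"
  assume "\<not> ?thesis"
  then have small: "(\<Sum>t = 1..T. ?loss S t) < real T * (?\<delta> / 4)" for S
    by (simp add: not_le)
  have "2 ^ T * (?\<delta> / 4) \<le> (\<Sum>S\<in>Pow {..<T}. ?loss S t)" if t: "t \<in> {1..T}" for t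
  proof -
    have "2 ^ card {..<T} * (?\<delta> / 2 / 2) \<le> (\<Sum>S\<in>Pow {..<T}. ?loss S t)"
    proof (rule sum_Pow_pair_ge)
      have "(t - 1) div n \<le> t - 1" by (rule div_le_dividend)
      moreover have "t - 1 < T" using t by auto
      ultimately show "(t - 1) div n \<in> {..<T}"
        unfolding lessThan_iff by (rule le_less_trans)
      fix S assume "(t - 1) div n \<notin> S"
      then have "?\<delta> / 2 \<le> ?loss (insert ((t - 1) div n) S) t + ?loss S t"
        unfolding block_laws_def
        using block_amplitude_bounds[OF assms(1-3)] block_weight_bounds[OF assms(1-3)] assms t
        by (intro two_point_expected_loss block_weight_chi2) (auto simp: block_weight_def less_imp_le)
      then show "?\<delta> / 2 \<le> ?loss S t + ?loss (insert ((t - 1) div n) S) t" by simp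
    qed simp
    then show ?thesis by simp
  qed
  then have "(\<Sum>t = 1..T. 2 ^ T * (?\<delta> / 4)) \<le> (\<Sum>t = 1..T. \<Sum>S\<in>Pow {..<T}. ?loss S t)"
    by (intro sum_mono)
  also have "\<dots> = (\<Sum>S\<in>Pow {..<T}. \<Sum>t = 1..T. ?loss S t)"
    by (rule sum.swap)
  also have "\<dots> < (\<Sum>S\<in>Pow {..<T}. real T * (?\<delta> / 4))"
    using small by (intro sum_strict_mono) auto
  finally show False
    by (simp add: card_Pow)
qed

lemma regret_ge_block_rate:
  assumes "0 < \<alpha>" "\<alpha> < 1" "1 \<le> n" "\<pi> \<in> admissible"
    and L: "\<And>S. block_laws \<alpha> n S \<in> L" "L \<subseteq> score_laws T"
  shows "ereal (min \<alpha> (1 - \<alpha>) / 32 * (real T / sqrt (real n))) \<le> regret \<alpha> \<pi> L T"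
proof -
  obtain S where "real T * (block_amplitude \<alpha> n / 4) \<le> (\<Sum>t = 1..T. expected_loss \<alpha> \<pi> T (block_laws \<alpha> n S) t)"
    using exists_hard_block_laws[OF assms(1-4)] by blast
  then have "ereal (real T * (block_amplitude \<alpha> n / 4)) \<le> ereal (\<Sum>t = 1..T. expected_loss \<alpha> \<pi> T (block_laws \<alpha> n S) t)"
    by simp
  also have "\<dots> \<le> regret \<alpha> \<pi> L T"
    using L by (intro regret_ge_sum_expected_loss)
  finally show ?thesis
    by (simp add: block_amplitude_def mult.commute)
qed

section \<open>Budgets of the block sequences\<close>

lemma block_laws_in_score_laws:
  assumes "0 < \<alpha>" "\<alpha> < 1" "1 \<le> n"
  shows "block_laws \<alpha> n S \<in> score_laws T"
  using block_weight_bounds[OF assms] unfolding score_laws_def block_laws_def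
  by (auto intro!: real_distribution_two_piece_law continuous_cdf_two_piece_law less_imp_le)

text \<open>The block index increases from \<open>t\<close> to \<open>t + 1\<close> only if \<open>n\<close> divides \<open>t\<close>.\<close>

lemma card_block_boundaries:
  assumes "1 \<le> n"
  shows "card {t \<in> {1..<T}. (t - 1) div n \<noteq> t div n} \<le> (T - 1) div n"
proof -
  have "{t \<in> {1..<T}. (t - 1) div n \<noteq> t div n} \<subseteq> (\<lambda>k. k * n) ` {1..(T - 1) div n}"
  proof
    fix t assume "t \<in> {t \<in> {1..<T}. (t - 1) div n \<noteq> t div n}"
    then have t: "1 \<le> t" "t < T" "(t - 1) div n \<noteq> t div n" by auto
    have "n dvd t"
      using t div_Suc[of "t - 1" n] by (auto simp: dvd_eq_mod_eq_0 split: if_splits)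
    then obtain k where k: "t = k * n" by (metis dvdE mult.commute)
    have "t div n \<le> (T - 1) div n" using t by (intro div_le_mono) auto
    moreover have "t div n = k" "k \<noteq> 0" using k t assms by auto
    ultimately show "t \<in> (\<lambda>k. k * n) ` {1..(T - 1) div n}"
      using k by auto
  qed
  then have "card {t \<in> {1..<T}. (t - 1) div n \<noteq> t div n} \<le> card ((\<lambda>k. k * n) ` {1..(T - 1) div n})"
    by (intro card_mono) auto
  also have "\<dots> \<le> (T - 1) div n"
    using card_image_le[of "{1..(T - 1) div n}"] by simp
  finally show ?thesis .
qed

lemma block_laws_in_L1:
  assumes "0 < \<alpha>" "\<alpha> < 1" "1 \<le> n" and "(T - 1) div n \<le> N"
  shows "block_laws \<alpha> n S \<in> L1 T N"
proof -
  have "card {t \<in> {1..<T}. block_laws \<alpha> n S t \<noteq> block_laws \<alpha> n S (t + 1)}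
      \<le> card {t \<in> {1..<T}. (t - 1) div n \<noteq> t div n}"
    by (intro card_mono) (auto simp: block_laws_def block_weight_def)
  also have "\<dots> \<le> N"
    using card_block_boundaries[of n T] assms by simp
  finally show ?thesis
    using block_laws_in_score_laws[OF assms(1-3)] by (simp add: L1_def)
qed

lemma block_laws_in_L2:
  assumes "0 < \<alpha>" "\<alpha> < 1" "1 \<le> n" and K: "real ((T - 1) div n) * (2 * block_amplitude \<alpha> n) \<le> K"
  shows "block_laws \<alpha> n S \<in> L2 T K"
proof -
  let ?B = "{t \<in> {1..<T}. (t - 1) div n \<noteq> t div n}"
  let ?\<delta> = "block_amplitude \<alpha> n"
  have \<delta>: "0 < ?\<delta>" using block_amplitude_bounds[OF assms(1-3)] by simp
  have "KS (block_laws \<alpha> n S t) (block_laws \<alpha> n S (t + 1)) \<le> (if t \<in> ?B then 2 * ?\<delta> else 0)"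
    if "t \<in> {1..<T}" for t
  proof -
    have "KS (block_laws \<alpha> n S t) (block_laws \<alpha> n S (t + 1))
        \<le> \<bar>block_weight \<alpha> n S t - block_weight \<alpha> n S (t + 1)\<bar>"
      unfolding block_laws_def using block_weight_bounds[OF assms(1-3)]
      by (intro KS_two_piece_law_le less_imp_le)
    also have "\<dots> \<le> (if t \<in> ?B then 2 * ?\<delta> else 0)"
      using that \<delta> by (auto simp: block_weight_def)
    finally show ?thesis .
  qed
  then have "(\<Sum>t = 1..<T. KS (block_laws \<alpha> n S t) (block_laws \<alpha> n S (t + 1)))
      \<le> (\<Sum>t = 1..<T. if t \<in> ?B then 2 * ?\<delta> else 0)"
    by (intro sum_mono)
  also have "\<dots> = (\<Sum>t\<in>?B. 2 * ?\<delta>)"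
    by (rule sum.mono_neutral_cong_right) auto
  also have "\<dots> = real (card ?B) * (2 * ?\<delta>)"
    by simp
  also have "\<dots> \<le> real ((T - 1) div n) * (2 * ?\<delta>)"
    using card_block_boundaries[of n T] assms(3) \<delta> by (intro mult_right_mono) auto
  also note K
  finally show ?thesis
    using block_laws_in_score_laws[OF assms(1-3)] by (simp add: L2_def)
qed

text \<open>The block length is \<open>T / (N + 1)\<close> rounded up, which leaves at most \<open>N\<close> boundaries. Since
  \<open>N + 1 \<le> T\<close>, rounding at most doubles it.\<close>

lemma regret_L1_ge:
  assumes "0 < \<alpha>" "\<alpha> < 1" "\<pi> \<in> admissible" and "1 \<le> N" "N \<le> T - 1"
  shows "ereal (min \<alpha> (1 - \<alpha>) / 64 * sqrt ((real N + 1) * real T)) \<le> regret \<alpha> \<pi> (L1 T N) T"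
proof -
  define m where "m = min \<alpha> (1 - \<alpha>)"
  have "0 < m" using assms by (simp add: m_def)
  define q where "q = (T - 1) div (N + 1)"
  define n where "n = q + 1"
  have NT: "N + 1 \<le> T" using assms by linarith
  define r where "r = (T - 1) mod (N + 1)"
  have "q * (N + 1) + r = T - 1"
    unfolding q_def r_def by (rule div_mult_mod_eq)
  moreover have "r < N + 1"
    unfolding r_def by simp
  ultimately have lt: "T - 1 < (N + 1) * n" and "(N + 1) * n \<le> 2 * T"
    using NT by (auto simp: n_def algebra_simps)
  then have "real ((N + 1) * n) \<le> real (2 * T)"
    by (simp only: of_nat_le_iff)
  then have upper: "(real N + 1) * real n \<le> 2 * real T"
    by (simp add: algebra_simps)
  have "(T - 1) div n \<le> N"
    using less_mult_imp_div_less[OF lt] by simp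
  then have rate: "ereal (m / 32 * (real T / sqrt (real n))) \<le> regret \<alpha> \<pi> (L1 T N) T"
    unfolding m_def using assms
    by (intro regret_ge_block_rate block_laws_in_L1) (auto simp: n_def L1_def)
  have "sqrt ((real N + 1) * real T) * sqrt (real n) = sqrt ((real N + 1) * real n * real T)"
    by (simp add: real_sqrt_mult[symmetric] mult_ac)
  also have "\<dots> \<le> sqrt ((2 * real T) * (2 * real T))"
    by (intro real_sqrt_le_mono mult_mono[OF upper]) auto
  also have "\<dots> = 2 * real T"
    unfolding real_sqrt_mult[of "2 * real T" "2 * real T"] by simp
  finally have "sqrt ((real N + 1) * real T) * sqrt (real n) \<le> 2 * real T" .
  moreover have "0 < sqrt (real n)" by (simp add: n_def)
  ultimately have "sqrt ((real N + 1) * real T) / 2 \<le> real T / sqrt (real n)"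
    by (simp add: pos_le_divide_eq)
  then have "m / 64 * sqrt ((real N + 1) * real T) \<le> m / 32 * (real T / sqrt (real n))"
    using mult_left_mono[of "sqrt ((real N + 1) * real T) / 2" "real T / sqrt (real n)" "m / 32"] \<open>0 < m\<close>
    by simp
  then show ?thesis
    using order_trans[OF _ rate] by (simp add: m_def)
qed

text \<open>One block of length \<open>T\<close>: the sequence of laws is constant.\<close>

lemma regret_L2_ge_sqrt:
  assumes "0 < \<alpha>" "\<alpha> < 1" "\<pi> \<in> admissible" and "0 \<le> K" "1 \<le> T"
  shows "ereal (min \<alpha> (1 - \<alpha>) / 32 * sqrt (real T)) \<le> regret \<alpha> \<pi> (L2 T K) T"
proof -
  have "(T - 1) div T = 0" using assms by simp
  then have "ereal (min \<alpha> (1 - \<alpha>) / 32 * (real T / sqrt (real T))) \<le> regret \<alpha> \<pi> (L2 T K) T"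
    using assms by (intro regret_ge_block_rate block_laws_in_L2) (auto simp: L2_def)
  then show ?thesis by (simp add: real_div_sqrt)
qed

text \<open>With \<open>x = (T / K) powr (1/3)\<close> the block length is \<open>x\<^sup>2\<close> rounded up. The boundaries then use
  at most \<open>T / n * 2 * \<delta> \<le> T / (n * sqrt n) \<le> T / x ^ 3 = K\<close>, and the rate \<open>T / sqrt n\<close> is of order
  \<open>T / x = K powr (1/3) * T powr (2/3)\<close>. The hypothesis \<open>K \<le> T\<close> gives \<open>1 \<le> x\<close>, so that rounding costs
  only a constant.\<close>

lemma regret_L2_ge_cube_root:
  assumes "0 < \<alpha>" "\<alpha> < 1" "\<pi> \<in> admissible" and K: "0 < K" "K \<le> real T"
  shows "ereal (min \<alpha> (1 - \<alpha>) / 64 * (K powr (1/3) * real T powr (2/3))) \<le> regret \<alpha> \<pi> (L2 T K) T"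
proof -
  define m where "m = min \<alpha> (1 - \<alpha>)"
  have m: "0 < m" "m \<le> 1 / 2" using assms by (auto simp: m_def min_def)
  define x where "x = (real T / K) powr (1/3)"
  define n where "n = nat \<lceil>x\<^sup>2\<rceil>"
  have T: "0 < real T" using K by linarith
  have x1: "1 \<le> x" unfolding x_def using K by (intro ge_one_powr_ge_zero) auto
  have x3: "x ^ 3 = real T / K"
    unfolding x_def using K T by (simp add: powr_realpow[symmetric] powr_powr)
  have "K powr (1/3) * real T powr (2/3) * x = (K powr (1/3) / K powr (1/3)) * (real T powr (2/3) * real T powr (1/3))"
    unfolding x_def using K T by (simp add: powr_divide)
  also have "\<dots> = real T"
    using K T by (simp add: powr_add[symmetric])
  finally have Tx: "K powr (1/3) * real T powr (2/3) = real T / x"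
    using x1 by (simp add: field_simps)
  have x2: "1 \<le> x\<^sup>2" using x1 by simp
  have n: "x\<^sup>2 \<le> real n" "real n \<le> x\<^sup>2 + 1" "1 \<le> n"
    unfolding n_def using x2 by (auto simp: of_nat_nat ceiling_le_iff) linarith+
  have sqrt_lower: "x \<le> sqrt (real n)"
    using n(1) by (rule real_le_rsqrt)
  have sqrt_upper: "sqrt (real n) \<le> 2 * x"
  proof (rule real_le_lsqrt)
    show "real n \<le> (2 * x)\<^sup>2"
      unfolding power_mult_distrib using n(2) x2 by simp
  qed (use x1 in simp_all)
  have "real T / K = x\<^sup>2 * x"
    by (simp add: x3[symmetric] power3_eq_cube power2_eq_square)
  also have "\<dots> \<le> real n * sqrt (real n)"
    using n sqrt_lower x1 by (intro mult_mono) auto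
  finally have changes: "real T / (real n * sqrt (real n)) \<le> K"
    using K n x1 by (simp add: field_simps)
  have "real ((T - 1) div n) \<le> real T / real n"
    by (rule order_trans[OF of_nat_div_le_of_nat]) (simp add: divide_right_mono)
  then have "real ((T - 1) div n) * (2 * block_amplitude \<alpha> n) \<le> real T / real n * (2 * block_amplitude \<alpha> n)"
    using block_amplitude_bounds[OF assms(1,2) n(3)] by (intro mult_right_mono) auto
  also have "\<dots> = m / 4 * (real T / (real n * sqrt (real n)))"
    by (simp add: block_amplitude_def m_def mult_ac)
  also have "\<dots> \<le> 1 * K"
    using m changes K by (intro mult_mono) auto
  finally have "ereal (m / 32 * (real T / sqrt (real n))) \<le> regret \<alpha> \<pi> (L2 T K) T"
    unfolding m_def using assms n
    by (intro regret_ge_block_rate block_laws_in_L2) (auto simp: L2_def)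
  moreover have "real T / (2 * x) \<le> real T / sqrt (real n)"
    using sqrt_upper x1 n(3) by (intro divide_left_mono mult_pos_pos) auto
  then have "m / 64 * (K powr (1/3) * real T powr (2/3)) \<le> m / 32 * (real T / sqrt (real n))"
    using mult_left_mono[of "real T / (2 * x)" "real T / sqrt (real n)" "m / 32"] m
    by (simp add: Tx)
  ultimately show ?thesis
    unfolding m_def by (meson ereal_less_eq(3) order_trans)
qed

theorem theorem3p2:
  fixes \<alpha> :: real
  assumes "0 < \<alpha>" and "\<alpha> < 1"
  shows "(\<exists>c>0. \<forall>(T::nat) (N::nat) \<pi>.
            1 \<le> N \<longrightarrow> N \<le> T - 1 \<longrightarrow> \<pi> \<in> admissible \<longrightarrow>
            regret \<alpha> \<pi> (L1 T N) T \<ge> ereal (c * sqrt ((real N + 1) * real T)))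
       \<and> (\<exists>c>0. \<forall>(T::nat) (K::real) \<pi>.
            0 < K \<longrightarrow> K \<le> real T - 1 \<longrightarrow> \<pi> \<in> admissible \<longrightarrow>
            regret \<alpha> \<pi> (L2 T K) T \<ge>
              ereal (c * (sqrt (real T) + K powr (1/3) * real T powr (2/3))))"
proof -
  define m where "m = min \<alpha> (1 - \<alpha>)"
  have m: "0 < m" using assms by (simp add: m_def)
  have "ereal (m / 64 * sqrt ((real N + 1) * real T)) \<le> regret \<alpha> \<pi> (L1 T N) T"
    if "1 \<le> N" "N \<le> T - 1" "\<pi> \<in> admissible" for T N \<pi>
    unfolding m_def using assms that(3,1,2) by (rule regret_L1_ge)
  moreover have "ereal (m / 128 * (sqrt (real T) + K powr (1/3) * real T powr (2/3))) \<le> regret \<alpha> \<pi> (L2 T K) T"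
    if "0 < K" "K \<le> real T - 1" "\<pi> \<in> admissible" for T K \<pi>
  proof -
    define a b where "a = sqrt (real T)" and "b = K powr (1/3) * real T powr (2/3)"
    have a: "ereal (m / 32 * a) \<le> regret \<alpha> \<pi> (L2 T K) T"
      unfolding m_def a_def using assms that by (intro regret_L2_ge_sqrt) auto
    have b: "ereal (m / 64 * b) \<le> regret \<alpha> \<pi> (L2 T K) T"
      unfolding m_def b_def using assms that by (intro regret_L2_ge_cube_root) auto
    have "m * a \<ge> 0" using m by (simp add: a_def)
    then have "m / 128 * (a + b) \<le> max (m / 32 * a) (m / 64 * b)"
      by (simp add: field_simps max_def)
    then have "ereal (m / 128 * (a + b)) \<le> max (ereal (m / 32 * a)) (ereal (m / 64 * b))"
      by (simp add: ereal_max[symmetric] del: ereal_max)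
    also have "\<dots> \<le> regret \<alpha> \<pi> (L2 T K) T"
      using a b by simp
    finally show ?thesis by (simp add: a_def b_def)
  qed
  ultimately show ?thesis
    using m by (intro conjI exI[of _ "m / 64"] exI[of _ "m / 128"]) auto
qed

end
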